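(* Let $\Omega\subset\mathbb{R}^n$ be compact, $f\in C^1(\Omega)$ real-valued, $\rho:\mathbb{R}\to\mathbb{R}$ monotonically (strictly) decreasing with $\rho(f(x))>0$ for every $x\in\Omega$, $\tau(x)=\rho(f(x))$ (differentiable), and $m^{(k)}(x)=\tau^k(x)/\int_\Omega\tau^k(t)\,\mathrm{d}t$ for $x\in\Omega$, $k\in\mathbb{R}$. Let $$\Gamma_0^{(k)}=\left\{x\in\Omega:m^{(k)}(x)=\frac{1}{\mu(\Omega)}\right\}.$$ If $x\in\Gamma_0^{(k)}$ and $x$ moves to $x+\Delta x\in\Gamma_0^{(k+\Delta k)}$ when $k$ continuously increases to $k+\Delta k$, then (whenever the right-hand side is defined) $$\lim_{\Delta k\to0}\frac{f(x)-f(x+\Delta x)}{\Delta k}=\frac{\tau(x)}{k}\,\frac{\nabla f(x)\cdot\nabla\tau(x)}{\|\nabla\tau(x)\|^2}\left(\log(\tau(x))-\mathbb{E}^{(k)}(\log(\tau))\right).$$ In particular, if $\tau=e^{-f}$, then $$\lim_{\Delta k\to0}\frac{f(x)-f(x+\Delta x)}{\Delta k}=\frac{f(x)-\mathbb{E}^{(k)}(f)}{k}.$$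
   Context: $\mu$ denotes $n$-dimensional Lebesgue measure; it is implicit in the definition of $m^{(k)}$ that $\mu(\Omega)>0$. $\|\cdot\|$ is the Euclidean norm. For a function $h$ on $\Omega$, $\mathbb{E}^{(k)}(h)=\int_\Omega h(t)m^{(k)}(t)\,\mathrm{d}t$. The displacement $\Delta x$ depends on $\Delta k$. The set $\Gamma_0^{(k)}$ is regarded as the boundary of $D_0^{(k)}=\{x\in\Omega:m^{(k)}(x)\geqslant1/\mu(\Omega)\}$. *)

theory Defs
  imports "HOL-Analysis.Analysis"
begin

text \<open>
  Continuous differentiability on a set that need not be open.  At interior points the derivative
  is the ordinary one; at the other points it is only taken along the set.  No extension to a
  neighbourhood is demanded, but every function that is continuously differentiable on an open
  superset qualifies.
\<close>

definition C1_on :: "'a::euclidean_space set \<Rightarrow> ('a \<Rightarrow> real) \<Rightarrow> bool" where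
  "C1_on \<Omega> f \<longleftrightarrow>
     (\<exists>G. continuous_on \<Omega> G \<and> (\<forall>y\<in>\<Omega>. (f has_derivative (\<lambda>h. G y \<bullet> h)) (at y within \<Omega>)))"

text \<open>
  The exponent is real, hence \<open>powr\<close>; this is the genuine power because \<open>\<tau>\<close> is assumed positive
  on \<open>\<Omega>\<close> wherever these definitions are used.
\<close>

definition minima_density ::
    "(real^'n) set \<Rightarrow> (real^'n \<Rightarrow> real) \<Rightarrow> real \<Rightarrow> real^'n \<Rightarrow> real" where
  "minima_density \<Omega> \<tau> k x = \<tau> x powr k / (LINT t:\<Omega>|lebesgue. \<tau> t powr k)"

definition minima_expectation ::
    "(real^'n) set \<Rightarrow> (real^'n \<Rightarrow> real) \<Rightarrow> real \<Rightarrow> (real^'n \<Rightarrow> real) \<Rightarrow> real" where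
  "minima_expectation \<Omega> \<tau> k h = (LINT t:\<Omega>|lebesgue. h t * minima_density \<Omega> \<tau> k t)"

definition mean_level_set ::
    "(real^'n) set \<Rightarrow> (real^'n \<Rightarrow> real) \<Rightarrow> real \<Rightarrow> (real^'n) set" where
  "mean_level_set \<Omega> \<tau> k = {x\<in>\<Omega>. minima_density \<Omega> \<tau> k x = 1 / measure lebesgue \<Omega>}"

end

theory Submission
  imports Defs
begin

text \<open>
  On the level set at parameter \<open>k\<close> the value of \<open>\<tau>\<close> is the same at all points: \<open>ln (\<tau> x)\<close> equals
  \<open>L k = ln (I k / \<mu>(\<Omega>)) / k\<close>, where \<open>I k = \<integral>\<^sub>\<Omega> \<tau>\<^sup>k\<close>.  Differentiating \<open>I\<close> under the integral sign gives
  \<open>L' k = (E(ln \<tau>) - ln (\<tau> x)) / k\<close>.  Since \<open>f = \<rho>\<inverse> \<circ> \<tau>\<close>, the value of \<open>f\<close> along the motion is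
  \<open>\<rho>\<inverse> (exp (L (k + \<Delta>k)))\<close> whatever the path, and the derivative of \<open>\<rho>\<inverse>\<close> is read off from the
  derivatives of \<open>f\<close> and \<open>\<tau>\<close> at \<open>x\<close> in the direction of the gradient of \<open>\<tau>\<close>.
\<close>

section \<open>Differentiation of exponential integrals in the parameter\<close>

lemma set_integrable_lebesgue_compact:
  fixes f :: "'a::euclidean_space \<Rightarrow> real"
  assumes "compact S" "continuous_on S f"
  shows "set_integrable lebesgue S f"
  unfolding set_integrable_def
  by (rule integrable_completion[THEN iffD2])
    (use borel_integrable_compact[OF assms] in auto)

lemma exp_first_order_bound:
  fixes z :: real
  shows "\<bar>exp z - 1 - z\<bar> \<le> exp \<bar>z\<bar> * z\<^sup>2"
  using Taylor_exp_field[of z 1] by (simp add: power2_eq_square algebra_simps)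

text \<open>The first-order error of the integrand is at most \<open>h\<^sup>2\<close> times a
  continuous function free of \<open>h\<close>; integrated over a compact set, it bounds the error
  of the difference quotient by a multiple of \<open>\<bar>h\<bar>\<close>. With
  \<open>g = ln \<tau>\<close> this covers the integral of \<open>\<tau> powr k\<close>.\<close>

lemma DERIV_integral_exp:
  fixes g :: "'a::euclidean_space \<Rightarrow> real"
  assumes "compact S" "continuous_on S g"
  shows "((\<lambda>k. LINT t:S|lebesgue. exp (k * g t)) has_real_derivative
            (LINT t:S|lebesgue. g t * exp (k * g t))) (at k)"
proof -
  define I where "I = (\<lambda>k. LINT t:S|lebesgue. exp (k * g t))"
  define J where "J = (LINT t:S|lebesgue. g t * exp (k * g t))"
  \<comment> \<open>For \<open>\<bar>h\<bar> \<le> 1\<close>, the factor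
    \<open>exp \<bar>h * g t\<bar>\<close> in the Taylor remainder is at most
    \<open>exp \<bar>g t\<bar>\<close>, which makes this majorant independent of
    \<open>h\<close>.\<close>
  define w where "w = (\<lambda>t. (g t)\<^sup>2 * exp (k * g t + \<bar>g t\<bar>))"
  define W where "W = (LINT t:S|lebesgue. w t)"
  note cont = continuous_intros assms(2)
  have int_exp: "set_integrable lebesgue S (\<lambda>t. exp (c * g t))" for c
    by (intro set_integrable_lebesgue_compact assms(1) cont)
  have int_J: "set_integrable lebesgue S (\<lambda>t. h * (g t * exp (k * g t)))" for h
    by (intro set_integrable_lebesgue_compact assms(1) cont)
  have int_w: "set_integrable lebesgue S (\<lambda>t. h\<^sup>2 * w t)" for h
    unfolding w_def by (intro set_integrable_lebesgue_compact assms(1) cont)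
  have bound: "\<bar>(I (k + h) - I k) / h - J\<bar> \<le> \<bar>h\<bar> * W" if "h \<noteq> 0" "\<bar>h\<bar> \<le> 1" for h
  proof -
    define r where "r = (\<lambda>t. exp ((k + h) * g t) - exp (k * g t) - h * (g t * exp (k * g t)))"
    have pointwise: "\<bar>r t\<bar> \<le> h\<^sup>2 * w t" for t
    proof -
      have "\<bar>r t\<bar> = exp (k * g t) * \<bar>exp (h * g t) - 1 - h * g t\<bar>"
        by (subst abs_exp_cancel[symmetric], subst abs_mult[symmetric])
          (simp add: r_def algebra_simps exp_add)
      also have "\<dots> \<le> exp (k * g t) * (exp \<bar>h * g t\<bar> * (h * g t)\<^sup>2)"
        by (intro mult_left_mono exp_first_order_bound) auto
      also have "\<dots> \<le> exp (k * g t) * (exp \<bar>g t\<bar> * (h * g t)\<^sup>2)"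
        using that by (intro mult_left_mono mult_right_mono) (auto simp: abs_mult mult_left_le_one_le)
      also have "\<dots> = h\<^sup>2 * w t"
        by (simp add: w_def exp_add power_mult_distrib)
      finally show ?thesis .
    qed
    have int_r: "set_integrable lebesgue S r"
      unfolding r_def by (rule set_integral_diff(1)[OF set_integral_diff(1)[OF int_exp int_exp] int_J])
    have "I (k + h) - I k - h * J = (LINT t:S|lebesgue. r t)"
      unfolding I_def J_def r_def using int_exp int_J by (simp flip: set_integral_mult_right)
    also have "\<bar>\<dots>\<bar> \<le> (LINT t:S|lebesgue. \<bar>r t\<bar>)"
      using set_integral_norm_bound[OF int_r] by simp
    also have "\<dots> \<le> (LINT t:S|lebesgue. h\<^sup>2 * w t)"
      using pointwise by (rule set_integral_mono[OF set_integrable_abs[OF int_r] int_w])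
    also have "\<dots> = h\<^sup>2 * W"
      by (simp add: W_def)
    finally have "\<bar>I (k + h) - I k - h * J\<bar> / \<bar>h\<bar> \<le> h\<^sup>2 * W / \<bar>h\<bar>"
      by (rule divide_right_mono) simp
    moreover have "(I (k + h) - I k) / h - J = (I (k + h) - I k - h * J) / h"
      using that by (simp add: field_simps)
    moreover have "h\<^sup>2 * W / \<bar>h\<bar> = \<bar>h\<bar> * W"
      using that by (simp add: field_simps power2_eq_square)
    ultimately show ?thesis
      by (simp only: abs_divide)
  qed
  have "((\<lambda>h. (I (k + h) - I k) / h - J) \<longlongrightarrow> 0) (at 0)"
  proof (rule Lim_null_comparison)
    show "\<forall>\<^sub>F h in at 0. norm ((I (k + h) - I k) / h - J) \<le> \<bar>h\<bar> * W"
      unfolding eventually_at by (rule exI[of _ 1]) (auto simp: dist_real_def intro!: bound)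
    show "((\<lambda>h. \<bar>h\<bar> * W) \<longlongrightarrow> 0) (at 0)"
      by (intro tendsto_eq_intros) auto
  qed
  then show ?thesis
    unfolding DERIV_def I_def J_def by (simp add: LIM_zero_iff)
qed

section \<open>Derivative of the inverse of a monotone function\<close>

text \<open>
  Squeezing: \<open>\<rho> \<circ> p\<close> is almost linear at \<open>0\<close>, so a value \<open>u\<close> of \<open>\<rho>\<close> near \<open>\<rho> (p 0)\<close> lies between
  \<open>\<rho> (p s)\<close> and \<open>\<rho> (p s')\<close> for parameters \<open>s\<close>, \<open>s'\<close> both close to \<open>(u - \<rho> (p 0)) / b\<close>; monotonicity
  then traps the preimage of \<open>u\<close> between \<open>p s'\<close> and \<open>p s\<close>.
\<close>

lemma DERIV_inv_strict_antimono:
  fixes \<rho> p :: "real \<Rightarrow> real"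
  assumes mono: "strict_antimono_on UNIV \<rho>"
    and p: "(p has_real_derivative a) (at 0)"
    and q: "((\<lambda>s. \<rho> (p s)) has_real_derivative b) (at 0)"
    and "b \<noteq> 0"
  shows "(inv \<rho> has_real_derivative a / b) (at (\<rho> (p 0)) within range \<rho>)"
proof -
  have less: "\<rho> v < \<rho> u" if "u < v" for u v
    using mono that by (auto simp: monotone_on_def)
  then have le_cancel: "v \<le> u" if "\<rho> u \<le> \<rho> v" for u v
    using that by (meson not_less)
  have inj: "inj \<rho>"
    by (metis injI le_cancel order_antisym order_refl)
  have approx: "\<exists>d>0. \<forall>s. \<bar>s\<bar> < d \<longrightarrow> \<bar>F s - F 0 - D * s\<bar> \<le> \<epsilon> * \<bar>s\<bar>"
    if "(F has_real_derivative D) (at 0)" "\<epsilon> > 0" for F D \<epsilon>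
    using that unfolding has_field_derivative_def has_derivative_at_alt by auto
  show ?thesis
    unfolding has_field_derivative_def has_derivative_within_alt
  proof (intro conjI allI impI)
    fix e :: real
    assume "e > 0"
    \<comment> \<open>The bound 1 gives \<open>\<bar>h + c\<bar> \<le> 2 * \<bar>h\<bar>\<close> for
      shifts of size \<open>\<delta> * \<bar>h\<bar>\<close>; the other bound keeps the effect of
      such a shift on \<open>a * s\<close> below \<open>e * \<bar>h\<bar> / 2\<close>. Adding 1 to
      \<open>\<bar>a\<bar>\<close> covers \<open>a = 0\<close>.\<close>
    define \<delta> where "\<delta> = min 1 (e * \<bar>b\<bar> / (2 * (\<bar>a\<bar> + 1)))"
    have \<delta>: "0 < \<delta>" "\<delta> \<le> 1" "\<bar>a\<bar> * \<delta> \<le> e * \<bar>b\<bar> / 2"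
    proof -
      show "0 < \<delta>" "\<delta> \<le> 1"
        using \<open>e > 0\<close> \<open>b \<noteq> 0\<close> by (auto simp: \<delta>_def)
      have "\<bar>a\<bar> * \<delta> \<le> (\<bar>a\<bar> + 1) * (e * \<bar>b\<bar> / (2 * (\<bar>a\<bar> + 1)))"
        using \<open>0 < \<delta>\<close> by (intro mult_mono) (auto simp: \<delta>_def)
      also have "\<dots> = e * \<bar>b\<bar> / 2"
        by (simp add: field_simps)
      finally show "\<bar>a\<bar> * \<delta> \<le> e * \<bar>b\<bar> / 2" .
    qed
    \<comment> \<open>Since \<open>\<bar>s\<bar>\<close> will be at most
      \<open>2 * \<bar>h\<bar> / \<bar>b\<bar>\<close>, these two precisions yield errors of at most
      \<open>\<delta> * \<bar>h\<bar>\<close> for \<open>\<rho> \<circ> p\<close> and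
      \<open>e * \<bar>h\<bar> / 2\<close> for \<open>p\<close>.\<close>
    obtain d1 where d1: "d1 > 0"
      "\<And>s. \<bar>s\<bar> < d1 \<Longrightarrow> \<bar>\<rho> (p s) - \<rho> (p 0) - b * s\<bar> \<le> (\<delta> * \<bar>b\<bar> / 2) * \<bar>s\<bar>"
      using approx[OF q, of "\<delta> * \<bar>b\<bar> / 2"] \<open>0 < \<delta>\<close> \<open>b \<noteq> 0\<close> by auto
    obtain d2 where d2: "d2 > 0"
      "\<And>s. \<bar>s\<bar> < d2 \<Longrightarrow> \<bar>p s - p 0 - a * s\<bar> \<le> (e * \<bar>b\<bar> / 4) * \<bar>s\<bar>"
      using approx[OF p, of "e * \<bar>b\<bar> / 4"] \<open>0 < e\<close> \<open>b \<noteq> 0\<close> by auto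
    define m where "m = min d1 d2"
    then have m: "m > 0" "m \<le> d1" "m \<le> d2"
      using d1(1) d2(1) by auto
    define d where "d = m * \<bar>b\<bar> / 2"
    have estimate: "\<bar>\<rho> (p s) - \<rho> (p 0) - (h + c)\<bar> \<le> \<delta> * \<bar>h\<bar> \<and> \<bar>p s - p 0 - a / b * h\<bar> \<le> e * \<bar>h\<bar>"
      if "\<bar>h\<bar> < d" "\<bar>c\<bar> = \<delta> * \<bar>h\<bar>" "s = (h + c) / b" for h c s
    proof -
      have "\<bar>h + c\<bar> \<le> 2 * \<bar>h\<bar>"
        using that(2) \<delta>(1,2) mult_right_mono[of \<delta> 1 "\<bar>h\<bar>"] by linarith
      then have s: "\<bar>s\<bar> \<le> 2 * \<bar>h\<bar> / \<bar>b\<bar>"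
        using that(3) \<open>b \<noteq> 0\<close> by (simp add: divide_right_mono)
      also have "\<dots> < m"
        using that(1) \<open>b \<noteq> 0\<close> by (simp add: d_def field_simps)
      finally have small: "\<bar>s\<bar> < d1" "\<bar>s\<bar> < d2"
        using m(2,3) by auto
      have bs: "b * s = h + c"
        using that(3) \<open>b \<noteq> 0\<close> by simp
      have "(\<delta> * \<bar>b\<bar> / 2) * \<bar>s\<bar> \<le> (\<delta> * \<bar>b\<bar> / 2) * (2 * \<bar>h\<bar> / \<bar>b\<bar>)"
        using \<delta>(1) by (intro mult_left_mono s) auto
      then have 1: "(\<delta> * \<bar>b\<bar> / 2) * \<bar>s\<bar> \<le> \<delta> * \<bar>h\<bar>"
        using \<open>b \<noteq> 0\<close> by simp
      have "(e * \<bar>b\<bar> / 4) * \<bar>s\<bar> \<le> (e * \<bar>b\<bar> / 4) * (2 * \<bar>h\<bar> / \<bar>b\<bar>)"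
        using \<open>e > 0\<close> by (intro mult_left_mono s) auto
      then have 2: "(e * \<bar>b\<bar> / 4) * \<bar>s\<bar> \<le> e * \<bar>h\<bar> / 2"
        using \<open>b \<noteq> 0\<close> by simp
      have "\<bar>a * s - a / b * h\<bar> = (\<bar>a\<bar> * \<delta>) * \<bar>h\<bar> / \<bar>b\<bar>"
        using that(2,3) by (simp add: abs_mult abs_divide add_divide_distrib ring_distribs)
      also have "\<dots> \<le> (e * \<bar>b\<bar> / 2) * \<bar>h\<bar> / \<bar>b\<bar>"
        by (intro divide_right_mono mult_right_mono \<delta>(3)) auto
      also have "\<dots> = e * \<bar>h\<bar> / 2"
        using \<open>b \<noteq> 0\<close> by simp
      finally have 3: "\<bar>a * s - a / b * h\<bar> \<le> e * \<bar>h\<bar> / 2" .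
      show ?thesis
        using d1(2)[OF small(1)] d2(2)[OF small(2)] 1 2 3 unfolding bs by linarith
    qed
    show "\<exists>d>0. \<forall>u\<in>range \<rho>. norm (u - \<rho> (p 0)) < d \<longrightarrow>
            norm (inv \<rho> u - inv \<rho> (\<rho> (p 0)) - a / b * (u - \<rho> (p 0))) \<le> e * norm (u - \<rho> (p 0))"
    proof (intro exI[of _ d] conjI ballI impI)
      show "d > 0"
        using m(1) \<open>b \<noteq> 0\<close> by (simp add: d_def)
      fix u
      assume "u \<in> range \<rho>"
      then obtain v where v: "u = \<rho> v"
        by auto
      define h where "h = u - \<rho> (p 0)"
      assume "norm (u - \<rho> (p 0)) < d"
      then have h: "\<bar>h\<bar> < d"
        by (simp add: h_def)
      \<comment> \<open>The shift \<open>c\<close> equals the error bound of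
        \<open>\<rho> \<circ> p\<close> in size, so its sign decides on which side of
        \<open>u\<close> the value \<open>\<rho> (p s)\<close> falls: not below \<open>u\<close> for
        the positive shift, not above it for the negative one.\<close>
      note upper = estimate[OF h _ refl, of "\<delta> * \<bar>h\<bar>"]
      note lower = estimate[OF h _ refl, of "- (\<delta> * \<bar>h\<bar>)"]
      have "p ((h + \<delta> * \<bar>h\<bar>) / b) \<le> v"
        using upper \<delta>(1) by - (rule le_cancel, auto simp: h_def v abs_mult)
      moreover have "v \<le> p ((h + - (\<delta> * \<bar>h\<bar>)) / b)"
        using lower \<delta>(1) by - (rule le_cancel, auto simp: h_def v abs_mult)
      ultimately have "\<bar>v - p 0 - a / b * h\<bar> \<le> e * \<bar>h\<bar>"
        using upper lower \<delta>(1) by (simp add: abs_mult) linarith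
      then show "norm (inv \<rho> u - inv \<rho> (\<rho> (p 0)) - a / b * (u - \<rho> (p 0))) \<le> e * norm (u - \<rho> (p 0))"
        using inj by (simp add: h_def v)
    qed
  qed (auto intro: bounded_linear_mult_right)
qed

lemma DERIV_along_line:
  assumes "GDERIV f x :> g"
  shows "((\<lambda>s. f (x + s *\<^sub>R v)) has_real_derivative g \<bullet> v) (at 0)"
proof -
  have "((\<lambda>s. f (x + s *\<^sub>R v)) has_derivative (\<lambda>s. (s *\<^sub>R v) \<bullet> g)) (at 0)"
    by (rule has_derivative_compose[of "\<lambda>s. x + s *\<^sub>R v"])
      (use assms in \<open>auto simp: gderiv_def intro!: derivative_eq_intros\<close>)
  then show ?thesis
    by (simp add: has_field_derivative_def inner_commute mult_commute_abs)
qed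

text \<open>Take \<open>p\<close> to be \<open>f\<close> along the line through \<open>x\<close> in
  direction \<open>g'\<close>: the slopes of \<open>f\<close> and \<open>\<rho> \<circ> f\<close>
  there are \<open>g \<bullet> g'\<close> and \<open>g' \<bullet> g'\<close>, the latter
  nonzero.\<close>

lemma DERIV_inv_gradient:
  fixes f :: "'a::real_inner \<Rightarrow> real"
  assumes "strict_antimono_on UNIV \<rho>" "GDERIV f x :> g" "GDERIV (\<lambda>y. \<rho> (f y)) x :> g'" "g' \<noteq> 0"
  shows "(inv \<rho> has_real_derivative (g \<bullet> g') / (norm g')\<^sup>2) (at (\<rho> (f x)) within range \<rho>)"
  using DERIV_inv_strict_antimono[OF assms(1) DERIV_along_line[OF assms(2)] DERIV_along_line[OF assms(3)], of g']
    assms(4) by (simp add: power2_norm_eq_inner)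

section \<open>The common value of \<open>\<tau>\<close> on a level set, and its dependence on the
  exponent\<close>

text \<open>Positivity of the integral follows from the existence of \<open>y\<close> alone: the
  density at \<open>y\<close> is positive and so is its numerator, hence also its
  denominator.\<close>

lemma mean_level_set_ln:
  assumes "y \<in> mean_level_set \<Omega> \<tau> k" "\<tau> y > 0" "measure lebesgue \<Omega> > 0"
  shows "(LINT t:\<Omega>|lebesgue. \<tau> t powr k) > 0"
    and "k * ln (\<tau> y) = ln ((LINT t:\<Omega>|lebesgue. \<tau> t powr k) / measure lebesgue \<Omega>)"
proof -
  let ?I = "LINT t:\<Omega>|lebesgue. \<tau> t powr k"
  have eq: "\<tau> y powr k / ?I = 1 / measure lebesgue \<Omega>"
    using assms(1) by (simp add: mean_level_set_def minima_density_def)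
  then have "\<tau> y powr k / ?I > 0"
    using assms(3) by simp
  then show I: "?I > 0"
    using assms(2) by (simp add: zero_less_divide_iff)
  have "\<tau> y powr k = ?I / measure lebesgue \<Omega>"
    using eq I assms(3) by (simp add: field_simps)
  then show "k * ln (\<tau> y) = ln (?I / measure lebesgue \<Omega>)"
    using assms(2) by (metis ln_powr)
qed

text \<open>By the quotient rule, the logarithmic derivative of the integral produces the
  expectation, and the level set condition at \<open>x\<close> turns the remaining logarithm into
  \<open>k * ln (\<tau> x)\<close>.\<close>

lemma DERIV_log_mean:
  assumes "compact \<Omega>" "measure lebesgue \<Omega> > 0" "continuous_on \<Omega> \<tau>" "\<And>y. y \<in> \<Omega> \<Longrightarrow> \<tau> y > 0"
    and "k \<noteq> 0" "x \<in> mean_level_set \<Omega> \<tau> k"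
  shows "((\<lambda>k. ln ((LINT t:\<Omega>|lebesgue. \<tau> t powr k) / measure lebesgue \<Omega>) / k) has_real_derivative
            (minima_expectation \<Omega> \<tau> k (\<lambda>t. ln (\<tau> t)) - ln (\<tau> x)) / k) (at k)"
proof -
  define I where "I = (\<lambda>k. LINT t:\<Omega>|lebesgue. \<tau> t powr k)"
  define J where "J = (LINT t:\<Omega>|lebesgue. ln (\<tau> t) * \<tau> t powr k)"
  let ?\<mu> = "measure lebesgue \<Omega>"
  have \<Omega>: "\<Omega> \<in> sets lebesgue"
    using assms(1) by (simp add: lmeasurable_compact fmeasurableD)
  have x: "x \<in> \<Omega>"
    using assms(6) by (simp add: mean_level_set_def)
  have "continuous_on \<Omega> (\<lambda>t. ln (\<tau> t))"
    using assms(3,4) by (intro continuous_intros) force+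
  note DERIV_integral_exp[OF assms(1) this, of k]
  moreover have "(LINT t:\<Omega>|lebesgue. exp (c * ln (\<tau> t))) = I c" for c
    unfolding I_def using assms(4) by (intro set_lebesgue_integral_cong \<Omega>) (force simp: powr_def)
  moreover have "(LINT t:\<Omega>|lebesgue. ln (\<tau> t) * exp (k * ln (\<tau> t))) = J"
    unfolding J_def using assms(4) by (intro set_lebesgue_integral_cong \<Omega>) (force simp: powr_def)
  ultimately have I': "(I has_real_derivative J) (at k)"
    by simp
  have I: "I k > 0" and ln_eq: "ln (I k / ?\<mu>) = k * ln (\<tau> x)"
    using mean_level_set_ln[OF assms(6) assms(4)[OF x] assms(2)] by (simp_all add: I_def)
  have E: "minima_expectation \<Omega> \<tau> k (\<lambda>t. ln (\<tau> t)) = J / I k"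
    by (simp add: minima_expectation_def minima_density_def I_def J_def)
  have "((\<lambda>k. ln (I k / ?\<mu>) / k) has_real_derivative
      (J / ?\<mu> / (I k / ?\<mu>) * k - ln (I k / ?\<mu>)) / (k * k)) (at k)"
    using I assms(2,5) by (auto intro!: derivative_eq_intros I')
  also have "(J / ?\<mu> / (I k / ?\<mu>) * k - ln (I k / ?\<mu>)) / (k * k) = (J / I k - ln (\<tau> x)) / k"
    unfolding ln_eq using I assms(2,5) by (simp add: field_simps)
  finally show ?thesis
    by (simp add: I_def E)
qed

theorem theorem12:
  fixes \<Omega> :: "(real^'n) set"
    and f \<tau> :: "real^'n \<Rightarrow> real"
    and \<rho> :: "real \<Rightarrow> real"
    and k :: real
    and x :: "real^'n"
    and S :: "real set"
    and \<Delta>x :: "real \<Rightarrow> real^'n"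
  assumes "compact \<Omega>"
    and "measure lebesgue \<Omega> > 0"
    and "C1_on \<Omega> f"
    and "strict_antimono_on UNIV \<rho>"
    and "\<forall>y\<in>\<Omega>. \<rho> (f y) > 0"
    and "\<tau> = (\<lambda>y. \<rho> (f y))"
    and "\<tau> differentiable_on \<Omega>"
    and "k \<noteq> 0"
    and "x \<in> mean_level_set \<Omega> \<tau> k"
    and "\<forall>\<Delta>k\<in>S. x + \<Delta>x \<Delta>k \<in> mean_level_set \<Omega> \<tau> (k + \<Delta>k)"
  shows "(\<forall>grad_f grad_\<tau>. GDERIV f x :> grad_f \<longrightarrow> GDERIV \<tau> x :> grad_\<tau> \<longrightarrow> grad_\<tau> \<noteq> 0 \<longrightarrow>
            ((\<lambda>\<Delta>k. (f x - f (x + \<Delta>x \<Delta>k)) / \<Delta>k) \<longlongrightarrow>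
               \<tau> x / k * ((grad_f \<bullet> grad_\<tau>) / (norm grad_\<tau>)\<^sup>2) *
               (ln (\<tau> x) - minima_expectation \<Omega> \<tau> k (\<lambda>t. ln (\<tau> t)))) (at 0 within S))
       \<and> ((\<forall>y\<in>\<Omega>. \<tau> y = exp (- f y)) \<longrightarrow>
            ((\<lambda>\<Delta>k. (f x - f (x + \<Delta>x \<Delta>k)) / \<Delta>k) \<longlongrightarrow>
               (f x - minima_expectation \<Omega> \<tau> k f) / k) (at 0 within S))"
proof -
  define L where "L = (\<lambda>k. ln ((LINT t:\<Omega>|lebesgue. \<tau> t powr k) / measure lebesgue \<Omega>) / k)"
  define E where "E = minima_expectation \<Omega> \<tau> k (\<lambda>t. ln (\<tau> t))"
  \<comment> \<open>At exponent 0 the level set is all of \<open>\<Omega>\<close> and does not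
    determine \<open>\<tau>\<close>, so \<open>- k\<close> is removed; as
    \<open>k \<noteq> 0\<close>, this leaves limits at 0 unchanged.\<close>
  define U where "U = S \<inter> - {- k}"
  have pos: "\<tau> y > 0" if "y \<in> \<Omega>" for y
    using assms(5,6) that by simp
  have x: "x \<in> \<Omega>"
    using assms(9) by (simp add: mean_level_set_def)
  have inj: "inj \<rho>"
    using assms(4) by (simp add: strict_antimono_iff_antimono)
  have level: "\<tau> y = exp (L c)" if "y \<in> mean_level_set \<Omega> \<tau> c" "c \<noteq> 0" for y c
  proof -
    have "\<tau> y > 0"
      using that(1) pos by (simp add: mean_level_set_def)
    then have "ln (\<tau> y) = L c"
      using mean_level_set_ln(2)[OF that(1) _ assms(2)] that(2) by (simp add: L_def field_simps)
    then show ?thesis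
      using \<open>\<tau> y > 0\<close> by (metis exp_ln)
  qed
  have level_x: "\<tau> x = exp (L k)"
    using level assms(8,9) by blast
  have level_\<Delta>: "\<tau> (x + \<Delta>x h) = exp (L (k + h))" "x + \<Delta>x h \<in> \<Omega>" if "h \<in> U" for h
    using that level[of "x + \<Delta>x h" "k + h"] assms(10)
    by (auto simp: U_def mean_level_set_def eq_neg_iff_add_eq_0 add.commute)
  have "(L has_real_derivative (E - ln (\<tau> x)) / k) (at k)"
    unfolding L_def E_def
    by (intro DERIV_log_mean differentiable_imp_continuous_on assms pos)
  then have L': "((\<lambda>h. L (k + h)) has_real_derivative (E - ln (\<tau> x)) / k) (at 0 within U)"
    using DERIV_at_within_shift[of L _ k 0 UNIV] by (auto intro: has_field_derivative_at_within)
  \<comment> \<open>Here \<open>F\<close> expresses \<open>f\<close> along the motion through the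
    parameter alone. Its value at 0 is prescribed separately because 0 need not belong to
    \<open>U\<close>.\<close>
  have quotient: "((\<lambda>h. (f x - f (x + \<Delta>x h)) / h) \<longlongrightarrow> - D) (at 0 within S)"
    if "(F has_real_derivative D) (at 0 within U)" "F 0 = f x" "\<And>h. h \<in> U \<Longrightarrow> f (x + \<Delta>x h) = F h" for F D
  proof -
    have "((\<lambda>h. - ((F h - F 0) / h)) \<longlongrightarrow> - D) (at 0 within U)"
      using that(1) by (intro tendsto_minus) (simp add: has_field_derivative_iff)
    then have "((\<lambda>h. (f x - f (x + \<Delta>x h)) / h) \<longlongrightarrow> - D) (at 0 within U)"
      by (rule Lim_transform_within[OF _ zero_less_one]) (simp add: that(2,3) minus_divide_left)
    moreover have "at 0 within U = at 0 within S"
      unfolding U_def using assms(8) by (intro at_within_nhd[of _ "- {- k}"]) auto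
    ultimately show ?thesis
      by simp
  qed
  show ?thesis
  proof (intro conjI allI impI)
    fix g g'
    assume g: "GDERIV f x :> g" "GDERIV \<tau> x :> g'" "g' \<noteq> 0"
    have T': "((\<lambda>h. exp (L (k + h))) has_real_derivative \<tau> x * ((E - ln (\<tau> x)) / k)) (at 0 within U)"
      using DERIV_chain2[OF DERIV_exp L'] by (simp add: level_x)
    have "(inv \<rho> has_real_derivative (g \<bullet> g') / (norm g')\<^sup>2) (at (\<tau> x) within range \<rho>)"
      using DERIV_inv_gradient[OF assms(4) g(1) _ g(3)] g(2) by (simp add: assms(6))
    \<comment> \<open>The derivative of \<open>inv \<rho>\<close> is known only within
      \<open>range \<rho>\<close>; for parameters in \<open>U\<close>,
      \<open>exp (L (k + h))\<close> is a value of \<open>\<tau>\<close> and so lies there, which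
      permits the chain rule within sets.\<close>
    moreover have "(\<lambda>h. exp (L (k + h))) ` U \<subseteq> range \<rho>"
      by (auto simp: assms(6) simp flip: level_\<Delta>(1))
    ultimately have "(inv \<rho> has_real_derivative (g \<bullet> g') / (norm g')\<^sup>2)
        (at (exp (L (k + 0))) within (\<lambda>h. exp (L (k + h))) ` U)"
      by (simp add: DERIV_subset level_x)
    from quotient[OF DERIV_image_chain[OF this T']]
    have "((\<lambda>h. (f x - f (x + \<Delta>x h)) / h) \<longlongrightarrow>
        - ((g \<bullet> g') / (norm g')\<^sup>2 * (\<tau> x * ((E - ln (\<tau> x)) / k)))) (at 0 within S)"
      using inj by (simp add: assms(6) flip: level_x level_\<Delta>(1))
    also have "- ((g \<bullet> g') / (norm g')\<^sup>2 * (\<tau> x * ((E - ln (\<tau> x)) / k))) =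
        \<tau> x / k * ((g \<bullet> g') / (norm g')\<^sup>2) * (ln (\<tau> x) - E)"
      by (simp add: diff_divide_distrib ring_distribs mult_ac)
    finally show "((\<lambda>\<Delta>k. (f x - f (x + \<Delta>x \<Delta>k)) / \<Delta>k) \<longlongrightarrow>
        \<tau> x / k * ((g \<bullet> g') / (norm g')\<^sup>2) *
        (ln (\<tau> x) - minima_expectation \<Omega> \<tau> k (\<lambda>t. ln (\<tau> t)))) (at 0 within S)"
      by (simp add: E_def)
  next
    assume exp_f: "\<forall>y\<in>\<Omega>. \<tau> y = exp (- f y)"
    have f_eq: "f y = - ln (\<tau> y)" if "y \<in> \<Omega>" for y
      using exp_f that by simp
    have "\<Omega> \<in> sets lebesgue"
      using assms(1) by (simp add: lmeasurable_compact fmeasurableD)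
    then have "minima_expectation \<Omega> \<tau> k f = (LINT t:\<Omega>|lebesgue. - (ln (\<tau> t) * minima_density \<Omega> \<tau> k t))"
      unfolding minima_expectation_def by (intro set_lebesgue_integral_cong) (auto simp: f_eq)
    also have "\<dots> = - E"
      by (simp add: E_def minima_expectation_def set_lebesgue_integral_def)
    finally have E: "minima_expectation \<Omega> \<tau> k f = - E" .
    \<comment> \<open>In this case \<open>f\<close> along the motion is simply
      \<open>- L (k + h)\<close>, so the derivative of \<open>L\<close> gives the limit without
      passing through \<open>inv \<rho>\<close>.\<close>
    have "((\<lambda>h. (f x - f (x + \<Delta>x h)) / h) \<longlongrightarrow> - (- ((E - ln (\<tau> x)) / k))) (at 0 within S)"
      by (rule quotient[OF DERIV_minus[OF L']]) (simp_all add: f_eq x level_x level_\<Delta>)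
    then show "((\<lambda>\<Delta>k. (f x - f (x + \<Delta>x \<Delta>k)) / \<Delta>k) \<longlongrightarrow>
        (f x - minima_expectation \<Omega> \<tau> k f) / k) (at 0 within S)"
      by (simp add: E f_eq x)
  qed
qed

end
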